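(* Let $\mathcal P$ be a prediction set with respect to a measure space $(\Omega,\mathcal A,\mu)$ and let $\Phi:\mathcal P^+\to\mathbb R$ be a sublinear function. Suppose that at a point $q\in\mathcal P^+$ the subspace $\mathcal O(q)$ of $\operatorname{span}\mathcal P$ has a trivial annihilator in $\mathcal L(\mathcal P)$. If there is a $q^*\in\mathcal L(\mathcal P)$ such that $$p\cdot q^*=\Phi_+'(p,q)$$ for all $p\in\mathcal P^+$, then $q^*$ is the unique $\mathcal P$-integrable subgradient of $\Phi$ at $q$.
   Context: A prediction set $\mathcal P$ is a convex set of probability densities on $\Omega$ with respect to $\mu$, where $(\Omega,\mathcal A,\mu)$ is a measure space. The prediction cone is $\mathcal P^+=\{\lambda p \mid \lambda>0,\ p\in\mathcal P\}$, and $\operatorname{span}\mathcal P$ is the linear span of $\mathcal P$. $\mathcal L(\mathcal P)$ is the set of all $\mu$-measurable functions $f:\Omega\to\mathbb R$ with $\int_\Omega |f(x)|p(x)\,d\mu(x)<\infty$ for all $p\in\mathcal P$. For $p\in\operatorname{span}\mathcal P$ and $f\in\mathcal L(\mathcal P)$, $p\cdot f=\int_\Omega f(x)p(x)\,d\mu(x)$. Functions that agree $\mu$-almost everywhere are identified. A function $\Phi:\mathcal P^+\to\mathbb R$ is sublinear if $\Phi(\lambda p)=\lambda\Phi(p)$ and $\Phi(p+r)\le\Phi(p)+\Phi(r)$ for all $p,r\in\mathcal P^+$, $\lambda>0$. A $\mathcal P$-integrable subgradient of $\Phi$ at $q\in\mathcal P^+$ is an element $q^*\in\mathcal L(\mathcal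 P)$ such that $\Phi(p)\ge p\cdot q^*$ for all $p\in\mathcal P^+$, with equality for $p=q$. For $q\in\mathcal P^+$ let $\mathcal D(q)=\{p\in\operatorname{span}\mathcal P\mid \exists\,\epsilon>0:\ q+\epsilon p\in\mathcal P^+\}$ (by convexity then $q+tp\in\mathcal P^+$ for all $t\in[0,\epsilon]$); it contains $\mathcal P^+$. Let $\mathcal O(q)=\mathcal D(q)\cap(-\mathcal D(q))$, which is a linear subspace of $\operatorname{span}\mathcal P$. For $p\in\mathcal D(q)$ the right directional derivative is $$\Phi_+'(p,q)=\lim_{t\to0^+}\frac{\Phi(q+tp)-\Phi(q)}{t},$$ which for sublinear $\Phi$ exists in $\mathbb R\cup\{-\infty\}$. For $E\subset\operatorname{span}\mathcal P$, the annihilator of $E$ in $\mathcal L(\mathcal P)$ is $E^\perp=\{f\in\mathcal L(\mathcal P)\mid p\cdot f=0\ \text{for all } p\in E\}$; it is trivial if $E^\perp=\{0\}$. *)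

theory Defs
  imports "HOL-Analysis.Analysis" "HOL-Library.Function_Algebras"
begin

(* Pointwise scalar multiplication on functions, so that the library notions convex and span
   apply to sets of real functions. *)

instantiation "fun" :: (type, real_vector) real_vector
begin

definition scaleR_fun :: "real \<Rightarrow> ('a \<Rightarrow> 'b) \<Rightarrow> 'a \<Rightarrow> 'b" where
  "scaleR_fun c f = (\<lambda>x. c *\<^sub>R f x)"

instance
  by standard
    (simp_all add: scaleR_fun_def plus_fun_def scaleR_add_right scaleR_add_left)

end

(* Functions that agree almost everywhere are identified.  A set of classes is encoded as the
   set of all measurable representatives of its members, so it is closed under almost everywhere
   equality; a function on classes is a function on representatives that respects it.  For the
   same reason densities are only required to be nonnegative almost everywhere. *)

definition ae_saturated :: "'a measure \<Rightarrow> ('a \<Rightarrow> real) set \<Rightarrow> bool" where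
  "ae_saturated M S \<longleftrightarrow>
    (\<forall>p\<in>S. \<forall>r\<in>borel_measurable M. (AE x in M. r x = p x) \<longrightarrow> r \<in> S)"

definition respects_ae :: "'a measure \<Rightarrow> ('a \<Rightarrow> real) set \<Rightarrow> (('a \<Rightarrow> real) \<Rightarrow> real) \<Rightarrow> bool" where
  "respects_ae M S \<Phi> \<longleftrightarrow> (\<forall>p\<in>S. \<forall>r\<in>S. (AE x in M. p x = r x) \<longrightarrow> \<Phi> p = \<Phi> r)"

definition prob_density :: "'a measure \<Rightarrow> ('a \<Rightarrow> real) \<Rightarrow> bool" where
  "prob_density M p \<longleftrightarrow>
    p \<in> borel_measurable M \<and> (AE x in M. 0 \<le> p x) \<and> (\<integral>\<^sup>+ x. ennreal (p x) \<partial>M) = 1"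

definition prediction_set :: "'a measure \<Rightarrow> ('a \<Rightarrow> real) set \<Rightarrow> bool" where
  "prediction_set M P \<longleftrightarrow> (\<forall>p\<in>P. prob_density M p) \<and> convex P \<and> ae_saturated M P"

definition prediction_cone :: "('a \<Rightarrow> real) set \<Rightarrow> ('a \<Rightarrow> real) set" where
  "prediction_cone P = {c *\<^sub>R p |c p. c > 0 \<and> p \<in> P}"

definition P_integrable :: "'a measure \<Rightarrow> ('a \<Rightarrow> real) set \<Rightarrow> ('a \<Rightarrow> real) set" where
  "P_integrable M P =
    {f \<in> borel_measurable M. \<forall>p\<in>P. (\<integral>\<^sup>+ x. ennreal (\<bar>f x\<bar> * p x) \<partial>M) < \<infinity>}"

definition pairing :: "'a measure \<Rightarrow> ('a \<Rightarrow> real) \<Rightarrow> ('a \<Rightarrow> real) \<Rightarrow> real" where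
  "pairing M p f = (\<integral>x. f x * p x \<partial>M)"

definition sublinear_on :: "('a \<Rightarrow> real) set \<Rightarrow> (('a \<Rightarrow> real) \<Rightarrow> real) \<Rightarrow> bool" where
  "sublinear_on C \<Phi> \<longleftrightarrow>
    (\<forall>p\<in>C. \<forall>c>0. \<Phi> (c *\<^sub>R p) = c * \<Phi> p) \<and> (\<forall>p\<in>C. \<forall>r\<in>C. \<Phi> (p + r) \<le> \<Phi> p + \<Phi> r)"

definition P_subgradient ::
  "'a measure \<Rightarrow> ('a \<Rightarrow> real) set \<Rightarrow> (('a \<Rightarrow> real) \<Rightarrow> real) \<Rightarrow> ('a \<Rightarrow> real) \<Rightarrow> ('a \<Rightarrow> real) \<Rightarrow> bool"
where
  "P_subgradient M P \<Phi> q f \<longleftrightarrow> f \<in> P_integrable M P \<and>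
    (\<forall>p\<in>prediction_cone P. \<Phi> p \<ge> pairing M p f) \<and> \<Phi> q = pairing M q f"

definition directions :: "('a \<Rightarrow> real) set \<Rightarrow> ('a \<Rightarrow> real) \<Rightarrow> ('a \<Rightarrow> real) set" where
  "directions P q = {p \<in> span P. \<exists>\<epsilon>>0. q + \<epsilon> *\<^sub>R p \<in> prediction_cone P}"

definition two_sided_directions :: "('a \<Rightarrow> real) set \<Rightarrow> ('a \<Rightarrow> real) \<Rightarrow> ('a \<Rightarrow> real) set" where
  "two_sided_directions P q = directions P q \<inter> uminus ` directions P q"

(* The limit is taken in the extended reals because it may be minus infinity. *)

definition right_dir_deriv ::
  "(('a \<Rightarrow> real) \<Rightarrow> real) \<Rightarrow> ('a \<Rightarrow> real) \<Rightarrow> ('a \<Rightarrow> real) \<Rightarrow> ereal" where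
  "right_dir_deriv \<Phi> p q = Lim (at_right 0) (\<lambda>t. ereal ((\<Phi> (q + t *\<^sub>R p) - \<Phi> q) / t))"

definition annihilator ::
  "'a measure \<Rightarrow> ('a \<Rightarrow> real) set \<Rightarrow> ('a \<Rightarrow> real) set \<Rightarrow> ('a \<Rightarrow> real) set" where
  "annihilator M P E = {f \<in> P_integrable M P. \<forall>p\<in>E. pairing M p f = 0}"

definition ae_trivial :: "'a measure \<Rightarrow> ('a \<Rightarrow> real) set \<Rightarrow> bool" where
  "ae_trivial M S \<longleftrightarrow> S = {f \<in> borel_measurable M. AE x in M. f x = 0}"

end

theory Submission
  imports Defs
begin

text \<open>
  Convexity makes the difference quotient of \<Phi> at q nondecreasing in the step t, so the directional
  derivative is its infimum over t > 0. The value at t = 1 bounds it above by \<Phi> p, which makes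
  q* a subgradient; any other subgradient f bounds all quotients below, so p \<cdot> f \<le> p \<cdot> q* on the
  cone, with equality at q. A two-sided direction p satisfies q \<plusminus> \<epsilon> p \<in> cone for small \<epsilon>, hence
  p \<cdot> f = p \<cdot> q*, and the trivial annihilator gives f = q* almost everywhere.
\<close>

lemma prediction_cone_scaleR:
  assumes "p \<in> prediction_cone P" "c > 0"
  shows "c *\<^sub>R p \<in> prediction_cone P"
proof -
  obtain a x where "a > 0" "x \<in> P" "p = a *\<^sub>R x"
    using assms(1) by (auto simp: prediction_cone_def)
  then have "c *\<^sub>R p = (c * a) *\<^sub>R x" "c * a > 0" "x \<in> P"
    using assms(2) by auto
  then show ?thesis
    unfolding prediction_cone_def by blast
qed

text \<open>Normalising the weights \<open>a\<close> and \<open>b\<close> by a + b turns the sum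
  into a + b times a convex combination of \<open>x\<close> and \<open>y\<close>. Convexity of
  \<open>P\<close> enters the development through this step.\<close>

lemma prediction_cone_add:
  assumes "convex P" "p \<in> prediction_cone P" "r \<in> prediction_cone P"
  shows "p + r \<in> prediction_cone P"
proof -
  obtain a x where a: "a > 0" "x \<in> P" "p = a *\<^sub>R x"
    using assms(2) by (auto simp: prediction_cone_def)
  obtain b y where b: "b > 0" "y \<in> P" "r = b *\<^sub>R y"
    using assms(3) by (auto simp: prediction_cone_def)
  define z where "z = (a / (a + b)) *\<^sub>R x + (b / (a + b)) *\<^sub>R y"
  have "z \<in> P"
    unfolding z_def using a b assms(1)
    by (intro convexD) (auto simp: add_divide_distrib[symmetric])
  moreover have "p + r = (a + b) *\<^sub>R z"
    using a b by (simp add: z_def scaleR_add_right)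
  ultimately show ?thesis
    using a b by (auto simp: prediction_cone_def intro!: exI[of _ "a + b"])
qed

text \<open>Densities are nonnegative almost everywhere, so the finite integral of \<bar>f\<bar> r
  is the integral of \<bar>f r\<bar>; the positive factor then passes through. Since the Bochner
  integral is 0 by default on nonintegrable functions, additivity of \<open>pairing\<close> rests on
  this.\<close>

lemma integrable_prediction_cone:
  assumes "prediction_set M P" "f \<in> P_integrable M P" "p \<in> prediction_cone P"
  shows "integrable M (\<lambda>x. f x * p x)"
proof -
  obtain a r where r: "r \<in> P" "p = a *\<^sub>R r"
    using assms(3) by (auto simp: prediction_cone_def)
  have dens: "r \<in> borel_measurable M" "AE x in M. 0 \<le> r x"
    using assms(1) r(1) by (auto simp: prediction_set_def prob_density_def)
  have f: "f \<in> borel_measurable M" "(\<integral>\<^sup>+ x. ennreal (\<bar>f x\<bar> * r x) \<partial>M) < \<infinity>"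
    using assms(2) r(1) by (auto simp: P_integrable_def)
  have "(\<integral>\<^sup>+ x. ennreal (norm (f x * r x)) \<partial>M) = (\<integral>\<^sup>+ x. ennreal (\<bar>f x\<bar> * r x) \<partial>M)"
    by (intro nn_integral_cong_AE) (use dens(2) in eventually_elim, simp add: abs_mult)
  then have "integrable M (\<lambda>x. f x * r x)"
    using f dens(1) by (intro integrableI_bounded) auto
  then have "integrable M (\<lambda>x. a * (f x * r x))"
    by simp
  moreover have "(\<lambda>x. f x * p x) = (\<lambda>x. a * (f x * r x))"
    by (simp add: r(2) scaleR_fun_def fun_eq_iff)
  ultimately show ?thesis
    by simp
qed

text \<open>Needed so that the difference of two subgradients can be tested for membership in the
  annihilator.\<close>

lemma P_integrable_diff:
  assumes "prediction_set M P" "f \<in> P_integrable M P" "g \<in> P_integrable M P"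
  shows "(\<lambda>x. f x - g x) \<in> P_integrable M P"
  unfolding P_integrable_def
proof (intro CollectI conjI ballI)
  show "(\<lambda>x. f x - g x) \<in> borel_measurable M"
    using assms by (auto simp: P_integrable_def)
next
  fix p assume p: "p \<in> P"
  have nonneg: "AE x in M. 0 \<le> p x"
    using assms(1) p by (auto simp: prediction_set_def prob_density_def)
  have "p \<in> prediction_cone P"
    using p by (auto simp: prediction_cone_def intro!: exI[of _ "1::real"])
  then have "integrable M (\<lambda>x. f x * p x - g x * p x)"
    using integrable_prediction_cone assms by (intro Bochner_Integration.integrable_diff)
  then have "(\<integral>\<^sup>+ x. ennreal (norm (f x * p x - g x * p x)) \<partial>M) < \<infinity>"
    by (simp add: integrable_iff_bounded)
  moreover have "(\<integral>\<^sup>+ x. ennreal (norm (f x * p x - g x * p x)) \<partial>M)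
      = (\<integral>\<^sup>+ x. ennreal (\<bar>f x - g x\<bar> * p x) \<partial>M)"
    by (intro nn_integral_cong_AE)
      (use nonneg in eventually_elim, simp add: abs_mult left_diff_distrib[symmetric])
  ultimately show "(\<integral>\<^sup>+ x. ennreal (\<bar>f x - g x\<bar> * p x) \<partial>M) < \<infinity>"
    by simp
qed

lemma pairing_diff_right:
  assumes "prediction_set M P" "f \<in> P_integrable M P" "g \<in> P_integrable M P"
    "p \<in> prediction_cone P"
  shows "pairing M p (\<lambda>x. f x - g x) = pairing M p f - pairing M p g"
  using integrable_prediction_cone[OF assms(1,2,4)] integrable_prediction_cone[OF assms(1,3,4)]
  by (simp add: pairing_def left_diff_distrib Bochner_Integration.integral_diff)

text \<open>The difference \<open>p - r\<close> may leave the cone and change sign; the integral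
  still splits because each term is integrable. Directions are paired in this way.\<close>

lemma pairing_diff_left:
  assumes "prediction_set M P" "f \<in> P_integrable M P"
    "p \<in> prediction_cone P" "r \<in> prediction_cone P"
  shows "pairing M (p - r) f = pairing M p f - pairing M r f"
  using integrable_prediction_cone[OF assms(1,2,3)] integrable_prediction_cone[OF assms(1,2,4)]
  by (simp add: pairing_def right_diff_distrib Bochner_Integration.integral_diff)

lemma pairing_add_left:
  assumes "prediction_set M P" "f \<in> P_integrable M P"
    "p \<in> prediction_cone P" "r \<in> prediction_cone P"
  shows "pairing M (p + r) f = pairing M p f + pairing M r f"
  using integrable_prediction_cone[OF assms(1,2,3)] integrable_prediction_cone[OF assms(1,2,4)]
  by (simp add: pairing_def distrib_left Bochner_Integration.integral_add)

lemma pairing_scaleR: "pairing M (c *\<^sub>R p) f = c * pairing M p f"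
  by (simp add: pairing_def scaleR_fun_def mult.left_commute)

lemma pairing_uminus: "pairing M (- p) f = - pairing M p f"
  by (simp add: pairing_def)

text \<open>A bound below the infimum holds at every point to the right of \<open>a\<close>. A bound
  above it holds at some \<open>t\<close>, and monotonicity carries it to all points between
  \<open>a\<close> and \<open>t\<close>.\<close>

lemma mono_tendsto_at_right_INF:
  fixes g :: "real \<Rightarrow> 'b::{complete_linorder, linorder_topology}"
  assumes "\<And>s t. a < s \<Longrightarrow> s \<le> t \<Longrightarrow> g s \<le> g t"
  shows "(g \<longlongrightarrow> (INF t\<in>{a<..}. g t)) (at_right a)"
proof (rule order_tendstoI)
  fix y assume "y < (INF t\<in>{a<..}. g t)"
  then have "\<And>t. a < t \<Longrightarrow> y < g t"
    by (auto intro: less_le_trans INF_lower)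
  then show "eventually (\<lambda>t. y < g t) (at_right a)"
    by (auto simp: eventually_at_right_field intro!: exI[of _ "a + 1"])
next
  fix y assume "(INF t\<in>{a<..}. g t) < y"
  then obtain t where t: "a < t" "g t < y"
    by (auto simp: INF_less_iff)
  then have "g s < y" if "a < s" "s < t" for s
    using assms[of s t] that by (meson le_less_trans less_imp_le)
  then show "eventually (\<lambda>t. g t < y) (at_right a)"
    using t(1) by (auto simp: eventually_at_right_field)
qed

text \<open>The point \<open>q + s p\<close> lies on the segment from \<open>q\<close> to
  \<open>q + t p\<close>, and a sublinear function is convex along that segment.\<close>

lemma difference_quotient_mono:
  assumes "convex P" "sublinear_on (prediction_cone P) \<Phi>"
    and q: "q \<in> prediction_cone P" and p: "p \<in> prediction_cone P" and "0 < s" "s \<le> t"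
  shows "(\<Phi> (q + s *\<^sub>R p) - \<Phi> q) / s \<le> (\<Phi> (q + t *\<^sub>R p) - \<Phi> q) / t"
proof (cases "s = t")
  \<comment> \<open>Strictness gives 1 - u > 0: the cone and homogeneity admit only positive
    factors.\<close>
  case False
  with assms have st: "0 < s" "s < t" by auto
  define u where "u = s / t"
  have u: "0 < u" "u < 1" "u * t = s"
    using st by (auto simp: u_def)
  have qt: "q + t *\<^sub>R p \<in> prediction_cone P"
    using assms st by (intro prediction_cone_add prediction_cone_scaleR) auto
  have "q + s *\<^sub>R p = (1 - u) *\<^sub>R q + u *\<^sub>R (q + t *\<^sub>R p)"
    using u(3) by (simp add: scaleR_add_right scaleR_diff_left)
  moreover have "\<Phi> ((1 - u) *\<^sub>R q + u *\<^sub>R (q + t *\<^sub>R p))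
      \<le> \<Phi> ((1 - u) *\<^sub>R q) + \<Phi> (u *\<^sub>R (q + t *\<^sub>R p))"
    using assms(2) prediction_cone_scaleR[OF q, of "1 - u"] prediction_cone_scaleR[OF qt, of u] u
    by (simp add: sublinear_on_def)
  moreover have "\<Phi> ((1 - u) *\<^sub>R q) = (1 - u) * \<Phi> q"
    "\<Phi> (u *\<^sub>R (q + t *\<^sub>R p)) = u * \<Phi> (q + t *\<^sub>R p)"
    using assms(2) q qt u by (simp_all add: sublinear_on_def)
  ultimately have "\<Phi> (q + s *\<^sub>R p) - \<Phi> q \<le> u * (\<Phi> (q + t *\<^sub>R p) - \<Phi> q)"
    by (simp add: left_diff_distrib right_diff_distrib)
  then have "(\<Phi> (q + s *\<^sub>R p) - \<Phi> q) / s \<le> u * (\<Phi> (q + t *\<^sub>R p) - \<Phi> q) / s"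
    using st by (intro divide_right_mono) auto
  also have "\<dots> = (\<Phi> (q + t *\<^sub>R p) - \<Phi> q) / t"
    using st by (simp add: u_def)
  finally show ?thesis .
qed simp

text \<open>For \<open>p\<close> in the cone every step t > 0 stays in the cone, so the infimum runs
  over all of them. It exists in the extended reals, possibly as minus infinity.\<close>

lemma right_dir_deriv_eq_INF:
  assumes "convex P" "sublinear_on (prediction_cone P) \<Phi>"
    "q \<in> prediction_cone P" "p \<in> prediction_cone P"
  shows "right_dir_deriv \<Phi> p q = (INF t\<in>{0<..}. ereal ((\<Phi> (q + t *\<^sub>R p) - \<Phi> q) / t))"
  unfolding right_dir_deriv_def
  by (intro tendsto_Lim mono_tendsto_at_right_INF)
    (use difference_quotient_mono[OF assms] in auto)

lemma right_dir_deriv_le: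
  assumes "convex P" "sublinear_on (prediction_cone P) \<Phi>"
    "q \<in> prediction_cone P" "p \<in> prediction_cone P"
  shows "right_dir_deriv \<Phi> p q \<le> ereal (\<Phi> p)"
proof -
  have "right_dir_deriv \<Phi> p q \<le> ereal ((\<Phi> (q + 1 *\<^sub>R p) - \<Phi> q) / 1)"
    unfolding right_dir_deriv_eq_INF[OF assms] by (rule INF_lower) simp
  \<comment> \<open>Subadditivity: \<Phi>(q + p) - \<Phi>(q) is at most \<Phi>(p).\<close>
  also have "\<dots> \<le> ereal (\<Phi> p)"
    using assms by (simp add: sublinear_on_def algebra_simps)
  finally show ?thesis .
qed

text \<open>By homogeneity the quotient along \<open>q\<close> is constant in \<open>t\<close>. This
  yields the equality at \<open>q\<close> required of a subgradient.\<close>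

lemma right_dir_deriv_self:
  assumes "convex P" "sublinear_on (prediction_cone P) \<Phi>" "q \<in> prediction_cone P"
  shows "right_dir_deriv \<Phi> q q = ereal (\<Phi> q)"
proof -
  have "(\<Phi> (q + t *\<^sub>R q) - \<Phi> q) / t = \<Phi> q" if "t > 0" for t
  proof -
    have "q + t *\<^sub>R q = (1 + t) *\<^sub>R q"
      by (simp add: scaleR_add_left)
    then have "\<Phi> (q + t *\<^sub>R q) = (1 + t) * \<Phi> q"
      using assms that by (simp add: sublinear_on_def)
    then show ?thesis
      using that by (simp add: field_simps)
  qed
  then show ?thesis
    unfolding right_dir_deriv_eq_INF[OF assms assms(3)] by simp
qed

text \<open>The pairing with \<open>f\<close> is additive, touches \<Phi> at \<open>q\<close> and
  stays below it at \<open>q + t p\<close>, so it bounds every quotient from below.\<close>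

lemma pairing_subgradient_le_right_dir_deriv:
  assumes "prediction_set M P" "sublinear_on (prediction_cone P) \<Phi>"
    "q \<in> prediction_cone P" "p \<in> prediction_cone P" "P_subgradient M P \<Phi> q f"
  shows "ereal (pairing M p f) \<le> right_dir_deriv \<Phi> p q"
proof -
  have conv: "convex P"
    using assms(1) by (simp add: prediction_set_def)
  have "pairing M p f \<le> (\<Phi> (q + t *\<^sub>R p) - \<Phi> q) / t" if "t > 0" for t
  proof -
    have tp: "t *\<^sub>R p \<in> prediction_cone P"
      using prediction_cone_scaleR assms(4) that .
    then have "pairing M (q + t *\<^sub>R p) f \<le> \<Phi> (q + t *\<^sub>R p)"
      using assms prediction_cone_add[OF conv] by (auto simp: P_subgradient_def)
    moreover have "pairing M (q + t *\<^sub>R p) f = \<Phi> q + t * pairing M p f"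
      using assms tp by (simp add: pairing_add_left pairing_scaleR P_subgradient_def)
    ultimately show ?thesis
      using that by (simp add: field_simps)
  qed
  then show ?thesis
    unfolding right_dir_deriv_eq_INF[OF conv assms(2-4)] by (auto intro!: INF_greatest)
qed

text \<open>A direction need not lie in the cone, so the comparison is made at
  \<open>q + \<epsilon> p\<close>, which does. Writing \<epsilon> p as the difference of this point
  and \<open>q\<close> cancels the contributions at \<open>q\<close>, where the pairings
  agree.\<close>

lemma pairing_diff_nonneg_directions:
  assumes "prediction_set M P" "f \<in> P_integrable M P" "g \<in> P_integrable M P"
    "q \<in> prediction_cone P" "pairing M q f = pairing M q g"
    and le: "\<And>p. p \<in> prediction_cone P \<Longrightarrow> pairing M p f \<le> pairing M p g"
    and p: "p \<in> directions P q"
  shows "0 \<le> pairing M p (\<lambda>x. g x - f x)"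
proof -
  obtain \<epsilon> where \<epsilon>: "\<epsilon> > 0" and c: "q + \<epsilon> *\<^sub>R p \<in> prediction_cone P"
    using p by (auto simp: directions_def)
  have "\<epsilon> * pairing M p (\<lambda>x. g x - f x) = pairing M ((q + \<epsilon> *\<^sub>R p) - q) (\<lambda>x. g x - f x)"
    by (simp add: pairing_scaleR)
  also have "\<dots> = pairing M (q + \<epsilon> *\<^sub>R p) g - pairing M (q + \<epsilon> *\<^sub>R p) f"
    using assms c P_integrable_diff[OF assms(1,3,2)]
    by (simp only: pairing_diff_left pairing_diff_right)
  also have "\<dots> \<ge> 0"
    using le[OF c] by simp
  finally show ?thesis
    using \<epsilon> by (simp add: zero_le_mult_iff)
qed

theorem theorem3p2:
  fixes M :: "'a measure"
    and P :: "('a \<Rightarrow> real) set"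
    and \<Phi> :: "('a \<Rightarrow> real) \<Rightarrow> real"
    and q qstar :: "'a \<Rightarrow> real"
  assumes "prediction_set M P"
    and "respects_ae M (prediction_cone P) \<Phi>"
    and "sublinear_on (prediction_cone P) \<Phi>"
    and "q \<in> prediction_cone P"
    and "ae_trivial M (annihilator M P (two_sided_directions P q))"
    and "qstar \<in> P_integrable M P"
    and "\<And>p. p \<in> prediction_cone P \<Longrightarrow> ereal (pairing M p qstar) = right_dir_deriv \<Phi> p q"
  shows "P_subgradient M P \<Phi> q qstar \<and>
    (\<forall>f. P_subgradient M P \<Phi> q f \<longrightarrow> (AE x in M. f x = qstar x))"
proof (intro conjI allI impI)
  have conv: "convex P"
    using assms(1) by (simp add: prediction_set_def)
  have self: "pairing M q qstar = \<Phi> q"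
    using assms(7)[OF assms(4)] right_dir_deriv_self[OF conv assms(3,4)] by simp
  show "P_subgradient M P \<Phi> q qstar"
    unfolding P_subgradient_def
  proof (intro conjI ballI)
    fix p assume p: "p \<in> prediction_cone P"
    \<comment> \<open>The derivative equals a real pairing here, so the extended inequality descends
      to the reals.\<close>
    show "pairing M p qstar \<le> \<Phi> p"
      using right_dir_deriv_le[OF conv assms(3,4) p] assms(7)[OF p] by (metis ereal_less_eq(3))
  qed (use assms(6) self in auto)
  fix f assume f: "P_subgradient M P \<Phi> q f"
  let ?d = "\<lambda>x. qstar x - f x"
  have fI: "f \<in> P_integrable M P" and fq: "pairing M q f = pairing M q qstar"
    using f self by (auto simp: P_subgradient_def)
  have le: "pairing M p f \<le> pairing M p qstar" if "p \<in> prediction_cone P" for p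
    using pairing_subgradient_le_right_dir_deriv[OF assms(1,3,4) that f] assms(7)[OF that]
    by (metis ereal_less_eq(3))
  note dir = pairing_diff_nonneg_directions[OF assms(1) fI assms(6,4) fq le]
  \<comment> \<open>Both \<open>p\<close> and \<open>- p\<close> are directions, so the pairing with
    \<open>?d\<close> is nonnegative and nonpositive.\<close>
  have "pairing M p ?d = 0" if "p \<in> two_sided_directions P q" for p
    using that dir[of p] dir[of "- p"] by (auto simp: two_sided_directions_def pairing_uminus)
  then have "?d \<in> annihilator M P (two_sided_directions P q)"
    using P_integrable_diff[OF assms(1,6) fI] by (simp add: annihilator_def)
  then have "AE x in M. ?d x = 0"
    using assms(5) by (auto simp: ae_trivial_def)
  then show "AE x in M. f x = qstar x"
    by eventually_elim simp
qed

end
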